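(* The QCQP formulation of the synthesis problem for affine pMDPs is nonconvex in general. That is, there exist an affine pMDP $\mathcal{M}=(S,s_I,\mathit{Act},V,\mathcal{P})$, a target set $T\subseteq S$, a threshold $\lambda\in[0,1]$ and a constant $\varepsilon_{\mathrm{graph}}>0$ such that the following quadratically-constrained quadratic program in the variables $\vec{x}=((p_s)_{s\in S},(v)_{v\in V})$ is nonconvex, in the sense that the matrix $P_{s,\alpha}$ of at least one of its quadratic constraints is not positive semidefinite: $$\text{minimize}\quad p_{s_I}$$ subject to - $p_s=1$ for all $s\in T$; - $\mathcal{P}(s,\alpha,s')\ge\varepsilon_{\mathrm{graph}}$ for all $s,s'\in S$ and $\alpha\in A(s)$ such that $\mathcal{P}(s,\alpha,s')$ is not the zero polynomial; - $\sum_{s'\in S}\mathcal{P}(s,\alpha,s')=1$ for all $s\in S$, $\alpha\in A(s)$; - $\lambda\ge p_{s_I}$; - $p_s\ \ge\ \vec{x}^{T}P_{s,\alpha}\vec{x}+q_{s,\alpha}^{T}\vec{x}$ for all $s\in S\setminus T$, $\alpha\in A(s)$. Here $P_{s,\alpha}$ and $q_{s,\alpha}$ are the matrix and vector associated with $(s,\alpha)$ as defined in the context.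
   Context: A parametric Markov decision process (pMDP) is a tuple $\mathcal{M}=(S,s_I,\mathit{Act},V,\mathcal{P})$ with a finite set $S$ of states, an initial state $s_I\in S$, a finite set $\mathit{Act}$ of actions, a finite set $V$ of real-valued variables (parameters), and a transition function $\mathcal{P}\colon S\times\mathit{Act}\times S\to\mathbb{Q}[V]$, where $\mathbb{Q}[V]$ is the set of multivariate polynomials over $V$. It is affine if every $\mathcal{P}(s,\alpha,s')$ is an affine function of the parameters. The set of enabled actions at $s$ is $A(s)=\{\alpha\in\mathit{Act}\mid\exists s'\in S.\ \mathcal{P}(s,\alpha,s')\neq 0\}$ (nonzero as a polynomial), and $A(s)\neq\emptyset$ is assumed for every $s$. A quadratically-constrained quadratic program (QCQP) minimizes $\vec{x}^TP_0\vec{x}+q_0^T\vec{x}+r_0$ subject to $\vec{x}^TP_i\vec{x}+q_i^T\vec{x}+r_i\le 0$ for $i=1,\dots,m$, with symmetric matrices $P_i$. By convention it is called nonconvex if some $P_i$ is not positive semidefinite (a symmetric matrix $P$ is positive semidefinite if $\vec{x}^TP\vec{x}\ge 0$ for all real vectors $\vec{x}$). The vector $\vec{x}$ has $|S|+|V|$ entries, indexed by the probability variables $p_s$ ($s\in S$) and the parameters $v\in V$. For $s\in S\setminus T$ and $\alpha\in A(s)$, write $\mathcal{P}(s,\alpha,s')=\sum_{v\in V}a_{s',v}\,v+b_{s'}$. Then $P_{s,\alpha}$ is the symmetric $(|S|+|V|)\times(|S|+|V|)$ matrix whose entries at $(v,p_{s'})$ and $(p_{s'},v)$ are $a_{s',v}/2$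 and all of whose other entries are $0$, and $q_{s,\alpha}$ is the vector whose entry at $p_{s'}$ is $b_{s'}$ and whose entries at parameters are $0$. Thus $\vec{x}^TP_{s,\alpha}\vec{x}+q_{s,\alpha}^T\vec{x}=\sum_{s'\in S}\mathcal{P}(s,\alpha,s')\cdot p_{s'}$. *)

theory Defs
  imports Complex_Main "HOL-Library.Poly_Mapping"
begin

text \<open>The polynomial ring over \<open>\<rat>\<close> with variables in \<open>'v\<close>: finitely supported maps from
  monomials (finitely supported exponent vectors) to coefficients.  The coefficient of the
  monomial \<open>v\<close> is \<open>Poly_Mapping.lookup p (Poly_Mapping.single v 1)\<close>, the constant coefficient is \<open>Poly_Mapping.lookup p 0\<close>.\<close>

type_synonym 'v rpoly = "('v \<Rightarrow>\<^sub>0 nat) \<Rightarrow>\<^sub>0 rat"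

definition poly_vars :: "'v rpoly \<Rightarrow> 'v set" where
  "poly_vars p = (\<Union>m\<in>Poly_Mapping.keys p. Poly_Mapping.keys m)"

definition affine_poly :: "'v rpoly \<Rightarrow> bool" where
  "affine_poly p \<longleftrightarrow> (\<forall>m\<in>Poly_Mapping.keys p. (\<Sum>v\<in>Poly_Mapping.keys m. Poly_Mapping.lookup m v) \<le> 1)"

definition eval_poly :: "('v \<Rightarrow> real) \<Rightarrow> 'v rpoly \<Rightarrow> real" where
  "eval_poly \<sigma> p = (\<Sum>m\<in>Poly_Mapping.keys p. of_rat (Poly_Mapping.lookup p m) * (\<Prod>v\<in>Poly_Mapping.keys m. \<sigma> v ^ Poly_Mapping.lookup m v))"

definition lin_coeff :: "'v rpoly \<Rightarrow> 'v \<Rightarrow> real" where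
  "lin_coeff p v = of_rat (Poly_Mapping.lookup p (Poly_Mapping.single v 1))"

definition const_coeff :: "'v rpoly \<Rightarrow> real" where
  "const_coeff p = of_rat (Poly_Mapping.lookup p 0)"

record ('s, 'a, 'v) pmdp =
  states :: "'s set"
  init :: 's
  actions :: "'a set"
  params :: "'v set"
  trans :: "'s \<Rightarrow> 'a \<Rightarrow> 's \<Rightarrow> 'v rpoly"

definition enabled :: "('s, 'a, 'v) pmdp \<Rightarrow> 's \<Rightarrow> 'a set" where
  "enabled M s = {\<alpha> \<in> actions M. \<exists>s'\<in>states M. trans M s \<alpha> s' \<noteq> 0}"

definition is_pmdp :: "('s, 'a, 'v) pmdp \<Rightarrow> bool" where
  "is_pmdp M \<longleftrightarrow>
     finite (states M) \<and> init M \<in> states M \<and> finite (actions M) \<and> finite (params M) \<and>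
     (\<forall>s\<in>states M. \<forall>\<alpha>\<in>actions M. \<forall>s'\<in>states M. poly_vars (trans M s \<alpha> s') \<subseteq> params M) \<and>
     (\<forall>s\<in>states M. enabled M s \<noteq> {})"

definition affine_pmdp :: "('s, 'a, 'v) pmdp \<Rightarrow> bool" where
  "affine_pmdp M \<longleftrightarrow> is_pmdp M \<and>
     (\<forall>s\<in>states M. \<forall>\<alpha>\<in>actions M. \<forall>s'\<in>states M. affine_poly (trans M s \<alpha> s'))"

text \<open>Vectors and matrices are functions on an explicit finite index set \<open>I\<close>; values outside
  \<open>I\<close> are irrelevant.  A triple \<open>(P, q, r)\<close> stands for \<open>x\<^sup>T P x + q\<^sup>T x + r\<close>.\<close>

type_synonym 'i vec = "'i \<Rightarrow> real"
type_synonym 'i mat = "'i \<Rightarrow> 'i \<Rightarrow> real"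
type_synonym 'i quad = "'i mat \<times> 'i vec \<times> real"

definition symmetric_mat :: "'i set \<Rightarrow> 'i mat \<Rightarrow> bool" where
  "symmetric_mat I P \<longleftrightarrow> (\<forall>i\<in>I. \<forall>j\<in>I. P i j = P j i)"

definition quad_form :: "'i set \<Rightarrow> 'i mat \<Rightarrow> 'i vec \<Rightarrow> real" where
  "quad_form I P x = (\<Sum>i\<in>I. \<Sum>j\<in>I. x i * P i j * x j)"

definition psd :: "'i set \<Rightarrow> 'i mat \<Rightarrow> bool" where
  "psd I P \<longleftrightarrow> (\<forall>x. quad_form I P x \<ge> 0)"

definition dot :: "'i set \<Rightarrow> 'i vec \<Rightarrow> 'i vec \<Rightarrow> real" where
  "dot I q x = (\<Sum>i\<in>I. q i * x i)"

definition quad_val :: "'i set \<Rightarrow> 'i quad \<Rightarrow> 'i vec \<Rightarrow> real" where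
  "quad_val I c x = (case c of (P, q, r) \<Rightarrow> quad_form I P x + dot I q x + r)"

text \<open>The program minimizes \<open>objective\<close> subject to \<open>c \<le> 0\<close> for all \<open>c \<in> constraints\<close>.\<close>

record 'i qcqp =
  indices :: "'i set"
  objective :: "'i quad"
  constraints :: "'i quad set"

definition is_qcqp :: "'i qcqp \<Rightarrow> bool" where
  "is_qcqp Q \<longleftrightarrow> finite (indices Q) \<and> finite (constraints Q) \<and>
     (\<forall>(P, q, r) \<in> insert (objective Q) (constraints Q). symmetric_mat (indices Q) P)"

definition feasible :: "'i qcqp \<Rightarrow> 'i vec \<Rightarrow> bool" where
  "feasible Q x \<longleftrightarrow> (\<forall>c\<in>constraints Q. quad_val (indices Q) c x \<le> 0)"

definition nonconvex_qcqp :: "'i qcqp \<Rightarrow> bool" where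
  "nonconvex_qcqp Q \<longleftrightarrow> is_qcqp Q \<and>
     (\<exists>(P, q, r) \<in> insert (objective Q) (constraints Q). \<not> psd (indices Q) P)"

text \<open>The index \<open>Inl s\<close> is the probability variable \<open>p\<^sub>s\<close>, the index \<open>Inr v\<close> the parameter \<open>v\<close>.\<close>

definition qcqp_indices :: "('s, 'a, 'v) pmdp \<Rightarrow> ('s + 'v) set" where
  "qcqp_indices M = states M <+> params M"

definition quad_mat :: "('s, 'a, 'v) pmdp \<Rightarrow> 's \<Rightarrow> 'a \<Rightarrow> ('s + 'v) mat" where
  "quad_mat M s \<alpha> i j = (case (i, j) of
      (Inr v, Inl s') \<Rightarrow> lin_coeff (trans M s \<alpha> s') v / 2
    | (Inl s', Inr v) \<Rightarrow> lin_coeff (trans M s \<alpha> s') v / 2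
    | _ \<Rightarrow> 0)"

definition quad_vec :: "('s, 'a, 'v) pmdp \<Rightarrow> 's \<Rightarrow> 'a \<Rightarrow> ('s + 'v) vec" where
  "quad_vec M s \<alpha> i = (case i of Inl s' \<Rightarrow> const_coeff (trans M s \<alpha> s') | Inr v \<Rightarrow> 0)"

definition zero_mat :: "'i mat" where
  "zero_mat = (\<lambda>i j. 0)"

definition unit_vec :: "'i \<Rightarrow> 'i vec" where
  "unit_vec k = (\<lambda>i. if i = k then 1 else 0)"

text \<open>Linear part of an affine polynomial in the parameters, as a vector over all variables.\<close>

definition poly_vec :: "'v rpoly \<Rightarrow> ('s + 'v) vec" where
  "poly_vec p i = (case i of Inl s \<Rightarrow> 0 | Inr v \<Rightarrow> lin_coeff p v)"

text \<open>The equation \<open>q\<^sup>T x + r = 0\<close>, as two inequalities.\<close>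

definition lin_eq :: "'i vec \<Rightarrow> real \<Rightarrow> 'i quad set" where
  "lin_eq q r = {(zero_mat, q, r), (zero_mat, \<lambda>i. - q i, - r)}"

definition target_cons :: "'s set \<Rightarrow> ('s + 'v) quad set" where
  "target_cons T = (\<Union>s\<in>T. lin_eq (unit_vec (Inl s)) (- 1))"

definition graph_cons :: "('s, 'a, 'v) pmdp \<Rightarrow> real \<Rightarrow> ('s + 'v) quad set" where
  "graph_cons M \<epsilon> =
     {(zero_mat, \<lambda>i. - poly_vec (trans M s \<alpha> s') i, \<epsilon> - const_coeff (trans M s \<alpha> s'))
      | s \<alpha> s'. s \<in> states M \<and> s' \<in> states M \<and> \<alpha> \<in> enabled M s \<and> trans M s \<alpha> s' \<noteq> 0}"

definition stoch_cons :: "('s, 'a, 'v) pmdp \<Rightarrow> ('s + 'v) quad set" where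
  "stoch_cons M = (\<Union>s\<in>states M. \<Union>\<alpha>\<in>enabled M s.
     lin_eq (\<lambda>i. \<Sum>s'\<in>states M. poly_vec (trans M s \<alpha> s') i)
            ((\<Sum>s'\<in>states M. const_coeff (trans M s \<alpha> s')) - 1))"

definition threshold_con :: "('s, 'a, 'v) pmdp \<Rightarrow> real \<Rightarrow> ('s + 'v) quad" where
  "threshold_con M thr = (zero_mat, unit_vec (Inl (init M)), - thr)"

definition quad_con :: "('s, 'a, 'v) pmdp \<Rightarrow> 's \<Rightarrow> 'a \<Rightarrow> ('s + 'v) quad" where
  "quad_con M s \<alpha> = (quad_mat M s \<alpha>, \<lambda>i. quad_vec M s \<alpha> i - unit_vec (Inl s) i, 0)"

definition synthesis_qcqp ::
  "('s, 'a, 'v) pmdp \<Rightarrow> 's set \<Rightarrow> real \<Rightarrow> real \<Rightarrow> ('s + 'v) qcqp" where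
  "synthesis_qcqp M T thr \<epsilon> =
     \<lparr> indices = qcqp_indices M,
       objective = (zero_mat, unit_vec (Inl (init M)), 0),
       constraints = target_cons T \<union> graph_cons M \<epsilon> \<union> stoch_cons M \<union> {threshold_con M thr} \<union>
         {quad_con M s \<alpha> | s \<alpha>. s \<in> states M - T \<and> \<alpha> \<in> enabled M s} \<rparr>"

lemma affine_monomial:
  assumes "(\<Sum>v\<in>Poly_Mapping.keys m. Poly_Mapping.lookup m v) \<le> (1::nat)"
  shows "m = 0 \<or> (\<exists>v. m = Poly_Mapping.single v 1)"
proof (cases "Poly_Mapping.keys m = {}")
  case True
  then show ?thesis by simp
next
  case False
  then obtain v where v: "v \<in> Poly_Mapping.keys m" by blast
  have pos: "Poly_Mapping.lookup m w \<ge> 1" if "w \<in> Poly_Mapping.keys m" for w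
    using that by (simp add: in_keys_iff)
  have split: "(\<Sum>v\<in>Poly_Mapping.keys m. Poly_Mapping.lookup m v) = Poly_Mapping.lookup m v + (\<Sum>v\<in>Poly_Mapping.keys m - {v}. Poly_Mapping.lookup m v)"
    using v by (simp add: sum.remove)
  have zero: "(\<Sum>v\<in>Poly_Mapping.keys m - {v}. Poly_Mapping.lookup m v) = 0" and one: "Poly_Mapping.lookup m v = 1"
    using split assms pos[OF v] by linarith+
  have "Poly_Mapping.lookup m w = 0" if "w \<noteq> v" for w
  proof (cases "w \<in> Poly_Mapping.keys m")
    case True
    then show ?thesis using zero that by simp
  next
    case False
    then show ?thesis by (simp add: in_keys_iff)
  qed
  then have "m = Poly_Mapping.single v 1"
    using one by (intro poly_mapping_eqI) (auto simp: lookup_single when_def)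
  then show ?thesis by blast
qed

lemma eval_affine:
  fixes p :: "'a rpoly"
  assumes "affine_poly p" "poly_vars p \<subseteq> V" "finite V"
  shows "eval_poly \<sigma> p = (\<Sum>v\<in>V. lin_coeff p v * \<sigma> v) + const_coeff p"
proof -
  let ?s = "\<lambda>v. Poly_Mapping.single v (1::nat)"
  let ?f = "\<lambda>m. of_rat (Poly_Mapping.lookup p m) * (\<Prod>v\<in>Poly_Mapping.keys m. \<sigma> v ^ Poly_Mapping.lookup m v)"
  have inj: "inj_on ?s V"
  proof (rule inj_onI)
    fix x y :: 'a
    assume "?s x = ?s y"
    then have "Poly_Mapping.keys (?s x) = Poly_Mapping.keys (?s y)" by simp
    then show "x = y" by simp
  qed
  have nz: "0 \<notin> ?s ` V"
  proof
    assume "0 \<in> ?s ` V"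
    then obtain v :: 'a where "0 = ?s v" by blast
    then have "Poly_Mapping.keys (0 :: 'a \<Rightarrow>\<^sub>0 nat) = Poly_Mapping.keys (?s v)" by simp
    then show False by simp
  qed
  have sub: "Poly_Mapping.keys p \<subseteq> insert 0 (?s ` V)"
  proof
    fix m assume m: "m \<in> Poly_Mapping.keys p"
    then have "m = 0 \<or> (\<exists>v. m = ?s v)"
      using assms(1) affine_monomial[of m] by (auto simp: affine_poly_def)
    moreover have "Poly_Mapping.keys m \<subseteq> V" using m assms(2) by (auto simp: poly_vars_def)
    ultimately show "m \<in> insert 0 (?s ` V)" by auto
  qed
  have "eval_poly \<sigma> p = sum ?f (insert 0 (?s ` V))"
    unfolding eval_poly_def
    using sub assms(3) by (intro sum.mono_neutral_left) (auto simp: in_keys_iff)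
  also have "\<dots> = ?f 0 + (\<Sum>v\<in>V. ?f (?s v))"
    using nz assms(3) inj by (simp add: sum.reindex)
  also have "\<dots> = (\<Sum>v\<in>V. lin_coeff p v * \<sigma> v) + const_coeff p"
    by (simp add: lin_coeff_def const_coeff_def)
  finally show ?thesis .
qed

context
  fixes M :: "('s, 'a, 'v) pmdp"
  assumes M: "affine_pmdp M"
begin

lemma fin: "finite (states M)" "finite (params M)" "finite (actions M)"
  using M by (auto simp: affine_pmdp_def is_pmdp_def)

lemma eval_trans:
  assumes "s \<in> states M" "\<alpha> \<in> actions M" "s' \<in> states M"
  shows "eval_poly \<sigma> (trans M s \<alpha> s') =
    (\<Sum>v\<in>params M. lin_coeff (trans M s \<alpha> s') v * \<sigma> v) + const_coeff (trans M s \<alpha> s')"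
  using M assms by (intro eval_affine) (auto simp: affine_pmdp_def is_pmdp_def)

lemma sum_indices:
  "(\<Sum>i\<in>qcqp_indices M. f i) = (\<Sum>s\<in>states M. f (Inl s)) + (\<Sum>v\<in>params M. (f (Inr v) :: real))"
  using fin by (simp add: qcqp_indices_def sum.Plus comp_def)

lemma quad_form_zero [simp]: "quad_form I zero_mat x = 0"
  by (simp add: quad_form_def zero_mat_def)

lemma dot_unit:
  assumes "s \<in> states M"
  shows "dot (qcqp_indices M) (unit_vec (Inl s)) x = x (Inl s)"
  using assms fin by (simp add: dot_def sum_indices unit_vec_def if_distrib[of "\<lambda>c. c * _"] cong: if_cong)

lemma dot_uminus: "dot I (\<lambda>i. - q i) x = - dot I q x"
  by (simp add: dot_def sum_negf)

lemma dot_diff: "dot I (\<lambda>i. q i - q' i) x = dot I q x - dot I q' x"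
  by (simp add: dot_def sum_subtractf left_diff_distrib)

lemma dot_poly_vec:
  "dot (qcqp_indices M) (poly_vec p) x = (\<Sum>v\<in>params M. lin_coeff p v * x (Inr v))"
  by (simp add: dot_def sum_indices poly_vec_def)

lemma dot_sum: "dot I (\<lambda>i. \<Sum>k\<in>K. q k i) x = (\<Sum>k\<in>K. dot I (q k) x)"
  unfolding dot_def sum_distrib_right by (rule sum.swap)

lemma symmetric_quad_mat: "symmetric_mat I (quad_mat M s \<alpha>)"
  by (auto simp: symmetric_mat_def quad_mat_def split: sum.splits)

lemma quad_mat_vec:
  assumes "s \<in> states M" "\<alpha> \<in> actions M"
  shows "quad_form (qcqp_indices M) (quad_mat M s \<alpha>) x + dot (qcqp_indices M) (quad_vec M s \<alpha>) x =
    (\<Sum>s'\<in>states M. eval_poly (x \<circ> Inr) (trans M s \<alpha> s') * x (Inl s'))"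
proof -
  let ?a = "\<lambda>s' v. lin_coeff (trans M s \<alpha> s') v"
  let ?h = "\<Sum>s'\<in>states M. \<Sum>v\<in>params M. x (Inl s') * (?a s' v / 2) * x (Inr v)"
  have "quad_form (qcqp_indices M) (quad_mat M s \<alpha>) x =
      ?h + (\<Sum>v\<in>params M. \<Sum>s'\<in>states M. x (Inr v) * (?a s' v / 2) * x (Inl s'))"
    by (simp add: quad_form_def sum_indices quad_mat_def)
  also have "(\<Sum>v\<in>params M. \<Sum>s'\<in>states M. x (Inr v) * (?a s' v / 2) * x (Inl s')) = ?h"
    by (subst sum.swap) (simp add: mult_ac)
  also have "?h + ?h = (\<Sum>s'\<in>states M. \<Sum>v\<in>params M. ?a s' v * x (Inr v) * x (Inl s'))"
    by (simp add: sum.distrib[symmetric] mult_ac)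
  finally have 1: "quad_form (qcqp_indices M) (quad_mat M s \<alpha>) x =
      (\<Sum>s'\<in>states M. \<Sum>v\<in>params M. ?a s' v * x (Inr v) * x (Inl s'))" .
  have 2: "dot (qcqp_indices M) (quad_vec M s \<alpha>) x =
      (\<Sum>s'\<in>states M. const_coeff (trans M s \<alpha> s') * x (Inl s'))"
    by (simp add: dot_def sum_indices quad_vec_def)
  show ?thesis
    unfolding 1 2 sum.distrib[symmetric]
    by (intro sum.cong refl) (simp add: eval_trans assms sum_distrib_right distrib_right)
qed

lemma is_qcqp_synthesis:
  assumes "T \<subseteq> states M"
  shows "is_qcqp (synthesis_qcqp M T thr \<epsilon>)"
proof -
  have en: "finite (enabled M s)" for s using fin by (simp add: enabled_def)
  have "finite T" using assms fin finite_subset by blast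
  then have f1: "finite (target_cons T :: ('s + 'v) quad set)"
    by (simp add: target_cons_def lin_eq_def)
  have f2: "finite (stoch_cons M)" using fin en by (simp add: stoch_cons_def lin_eq_def)
  have "graph_cons M \<epsilon> \<subseteq> (\<lambda>(s, \<alpha>, s').
      (zero_mat, \<lambda>i. - poly_vec (trans M s \<alpha> s') i, \<epsilon> - const_coeff (trans M s \<alpha> s')))
      ` (states M \<times> actions M \<times> states M)"
    by (force simp: graph_cons_def enabled_def)
  then have f3: "finite (graph_cons M \<epsilon>)"
    by (rule finite_subset) (simp add: fin)
  have "{quad_con M s \<alpha> | s \<alpha>. s \<in> states M - T \<and> \<alpha> \<in> enabled M s}
      \<subseteq> (\<lambda>(s, \<alpha>). quad_con M s \<alpha>) ` (states M \<times> actions M)"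
    by (force simp: enabled_def)
  then have f4: "finite {quad_con M s \<alpha> | s \<alpha>. s \<in> states M - T \<and> \<alpha> \<in> enabled M s}"
    by (rule finite_subset) (simp add: fin)
  have "symmetric_mat I zero_mat" for I :: "('s + 'v) set"
    by (simp add: symmetric_mat_def zero_mat_def)
  then show ?thesis
    using f1 f2 f3 f4 fin
    by (auto simp: is_qcqp_def synthesis_qcqp_def qcqp_indices_def target_cons_def graph_cons_def
      stoch_cons_def threshold_con_def quad_con_def lin_eq_def symmetric_quad_mat)
qed

lemma objective_synthesis:
  "quad_val (indices (synthesis_qcqp M T thr \<epsilon>)) (objective (synthesis_qcqp M T thr \<epsilon>)) x
     = x (Inl (init M))"
  using M by (simp add: synthesis_qcqp_def quad_val_def dot_unit affine_pmdp_def is_pmdp_def)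

lemma feasible_synthesis:
  fixes x :: "('s + 'v) vec"
  assumes T: "T \<subseteq> states M"
  defines "p \<equiv> x \<circ> Inl" and "\<sigma> \<equiv> x \<circ> Inr"
  shows "feasible (synthesis_qcqp M T thr \<epsilon>) x \<longleftrightarrow>
    (\<forall>s\<in>T. p s = 1) \<and>
    (\<forall>s\<in>states M. \<forall>s'\<in>states M. \<forall>\<alpha>\<in>enabled M s. trans M s \<alpha> s' \<noteq> 0 \<longrightarrow>
       eval_poly \<sigma> (trans M s \<alpha> s') \<ge> \<epsilon>) \<and>
    (\<forall>s\<in>states M. \<forall>\<alpha>\<in>enabled M s. (\<Sum>s'\<in>states M. eval_poly \<sigma> (trans M s \<alpha> s')) = 1) \<and>
    thr \<ge> p (init M) \<and>
    (\<forall>s\<in>states M - T. \<forall>\<alpha>\<in>enabled M s.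
       p s \<ge> (\<Sum>s'\<in>states M. eval_poly \<sigma> (trans M s \<alpha> s') * p s'))"
proof -
  let ?I = "qcqp_indices M"
  let ?ok = "\<lambda>C. \<forall>c\<in>C. quad_val ?I c x \<le> 0"
  have act: "\<alpha> \<in> actions M" if "\<alpha> \<in> enabled M s" for s \<alpha>
    using that by (simp add: enabled_def)
  have eq: "?ok (lin_eq q r) \<longleftrightarrow> dot ?I q x + r = 0" for q r
    by (auto simp: lin_eq_def quad_val_def dot_uminus)
  have ev: "eval_poly \<sigma> (trans M s \<alpha> s') =
      dot ?I (poly_vec (trans M s \<alpha> s')) x + const_coeff (trans M s \<alpha> s')"
    if "s \<in> states M" "\<alpha> \<in> enabled M s" "s' \<in> states M" for s \<alpha> s'
    using that by (simp add: eval_trans act dot_poly_vec \<sigma>_def)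
  have 1: "?ok (target_cons T) \<longleftrightarrow> (\<forall>s\<in>T. p s = 1)"
  proof -
    have "?ok (target_cons T) \<longleftrightarrow> (\<forall>s\<in>T. ?ok (lin_eq (unit_vec (Inl s)) (- 1)))"
      by (auto simp: target_cons_def)
    also have "\<dots> \<longleftrightarrow> (\<forall>s\<in>T. p s = 1)"
      unfolding eq using T by (intro ball_cong refl) (auto simp: dot_unit p_def subset_iff)
    finally show ?thesis .
  qed
  have 2: "?ok (graph_cons M \<epsilon>) \<longleftrightarrow>
      (\<forall>s\<in>states M. \<forall>s'\<in>states M. \<forall>\<alpha>\<in>enabled M s. trans M s \<alpha> s' \<noteq> 0 \<longrightarrow>
       eval_poly \<sigma> (trans M s \<alpha> s') \<ge> \<epsilon>)"
  proof -
    have "?ok (graph_cons M \<epsilon>) \<longleftrightarrow>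
      (\<forall>s\<in>states M. \<forall>s'\<in>states M. \<forall>\<alpha>\<in>enabled M s. trans M s \<alpha> s' \<noteq> 0 \<longrightarrow>
        quad_val ?I (zero_mat, \<lambda>i. - poly_vec (trans M s \<alpha> s') i,
          \<epsilon> - const_coeff (trans M s \<alpha> s')) x \<le> 0)"
      unfolding graph_cons_def by blast
    also have "\<dots> \<longleftrightarrow> (\<forall>s\<in>states M. \<forall>s'\<in>states M. \<forall>\<alpha>\<in>enabled M s. trans M s \<alpha> s' \<noteq> 0 \<longrightarrow>
       eval_poly \<sigma> (trans M s \<alpha> s') \<ge> \<epsilon>)"
      by (intro ball_cong refl) (simp add: quad_val_def dot_uminus ev algebra_simps)
    finally show ?thesis .
  qed
  have 3: "?ok (stoch_cons M) \<longleftrightarrow>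
      (\<forall>s\<in>states M. \<forall>\<alpha>\<in>enabled M s. (\<Sum>s'\<in>states M. eval_poly \<sigma> (trans M s \<alpha> s')) = 1)"
  proof -
    have "?ok (stoch_cons M) \<longleftrightarrow> (\<forall>s\<in>states M. \<forall>\<alpha>\<in>enabled M s.
      ?ok (lin_eq (\<lambda>i. \<Sum>s'\<in>states M. poly_vec (trans M s \<alpha> s') i)
            ((\<Sum>s'\<in>states M. const_coeff (trans M s \<alpha> s')) - 1)))"
      by (auto simp: stoch_cons_def)
    also have "\<dots> \<longleftrightarrow>
      (\<forall>s\<in>states M. \<forall>\<alpha>\<in>enabled M s. (\<Sum>s'\<in>states M. eval_poly \<sigma> (trans M s \<alpha> s')) = 1)"
      unfolding eq by (intro ball_cong refl) (simp add: dot_sum ev sum.distrib algebra_simps)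
    finally show ?thesis .
  qed
  have 4: "?ok {threshold_con M thr} \<longleftrightarrow> thr \<ge> p (init M)"
    using M by (simp add: threshold_con_def quad_val_def dot_unit p_def affine_pmdp_def is_pmdp_def)
  have 5: "?ok {quad_con M s \<alpha> | s \<alpha>. s \<in> states M - T \<and> \<alpha> \<in> enabled M s} \<longleftrightarrow>
      (\<forall>s\<in>states M - T. \<forall>\<alpha>\<in>enabled M s.
       p s \<ge> (\<Sum>s'\<in>states M. eval_poly \<sigma> (trans M s \<alpha> s') * p s'))"
  proof -
    have "?ok {quad_con M s \<alpha> | s \<alpha>. s \<in> states M - T \<and> \<alpha> \<in> enabled M s} \<longleftrightarrow>
      (\<forall>s\<in>states M - T. \<forall>\<alpha>\<in>enabled M s. quad_val ?I (quad_con M s \<alpha>) x \<le> 0)"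
      by blast
    also have "\<dots> \<longleftrightarrow> (\<forall>s\<in>states M - T. \<forall>\<alpha>\<in>enabled M s.
       p s \<ge> (\<Sum>s'\<in>states M. eval_poly \<sigma> (trans M s \<alpha> s') * p s'))"
    proof (intro ball_cong refl)
      fix s \<alpha> assume s: "s \<in> states M - T" "\<alpha> \<in> enabled M s"
      show "quad_val ?I (quad_con M s \<alpha>) x \<le> 0 \<longleftrightarrow>
        p s \<ge> (\<Sum>s'\<in>states M. eval_poly \<sigma> (trans M s \<alpha> s') * p s')"
        using quad_mat_vec[of s \<alpha> x] s act[of \<alpha> s]
        by (auto simp: quad_con_def quad_val_def dot_diff dot_unit p_def \<sigma>_def)
    qed
    finally show ?thesis .
  qed
  have "feasible (synthesis_qcqp M T thr \<epsilon>) x \<longleftrightarrow>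
      ?ok (target_cons T) \<and> ?ok (graph_cons M \<epsilon>) \<and> ?ok (stoch_cons M) \<and> ?ok {threshold_con M thr} \<and>
      ?ok {quad_con M s \<alpha> | s \<alpha>. s \<in> states M - T \<and> \<alpha> \<in> enabled M s}"
    unfolding feasible_def synthesis_qcqp_def qcqp.simps ball_Un by blast
  then show ?thesis unfolding 1 2 3 4 5 .
qed

end

end

theory Submission
  imports Defs
begin

text \<open>A matrix \<open>P\<^sub>s\<^sub>,\<^sub>\<alpha>\<close> has zero diagonal, so by restriction to a principal
  \<open>2 \<times> 2\<close> minor it is indefinite as soon as some transition probability at \<open>(s, \<alpha>)\<close>
  depends on a parameter. The smallest example is a biased coin that is tossed until it
  shows heads, with the bias as the only parameter.\<close>

lemma not_psd_zero_diagonal: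
  assumes "finite I" "symmetric_mat I P" "i \<in> I" "j \<in> I"
    and "P i i = 0" "P j j = 0" "P i j \<noteq> 0"
  shows "\<not> psd I P"
proof -
  \<comment> \<open>The entry at \<open>j\<close> has the sign opposite to \<open>P i j\<close>, so
    both mixed terms equal minus the square of \<open>P i j\<close>.\<close>
  define x where "x = (\<lambda>k. if k = i then 1 else if k = j then - P i j else 0)"
  have ij: "i \<noteq> j" using assms by auto
  have ji: "P j i = P i j" using assms by (simp add: symmetric_mat_def)
  \<comment> \<open>The support of \<open>x\<close> lies in \<open>{i, j}\<close>, so this collapses
    the outer and the inner sum alike.\<close>
  have restrict: "sum f I = sum f {i, j}" if "\<And>k. x k = 0 \<Longrightarrow> f k = 0" for f :: "'a \<Rightarrow> real"
    using assms(1,3,4) that by (intro sum.mono_neutral_right) (auto simp: x_def)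
  have "quad_form I P x = (\<Sum>k\<in>{i, j}. \<Sum>l\<in>{i, j}. x k * P k l * x l)"
    unfolding quad_form_def by (simp add: restrict)
  also have "\<dots> = - 2 * (P i j)\<^sup>2"
    using ij ji assms(5,6) by (simp add: x_def power2_eq_square)
  also have "\<dots> < 0" using assms(7) by simp
  finally show ?thesis by (auto simp: psd_def not_le)
qed

lemma not_psd_quad_mat:
  assumes "finite (states M)" "finite (params M)" "s' \<in> states M" "v \<in> params M"
    and "lin_coeff (trans M s \<alpha> s') v \<noteq> 0"
  shows "\<not> psd (qcqp_indices M) (quad_mat M s \<alpha>)"
proof (rule not_psd_zero_diagonal[where i = "Inl s'" and j = "Inr v"])
  show "symmetric_mat (qcqp_indices M) (quad_mat M s \<alpha>)"
    by (auto simp: symmetric_mat_def quad_mat_def split: sum.splits)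
qed (use assms in \<open>auto simp: qcqp_indices_def quad_mat_def\<close>)

definition var_poly :: "'v \<Rightarrow> 'v rpoly" where
  "var_poly v = Poly_Mapping.single (Poly_Mapping.single v 1) 1"

lemma keys_var_poly [simp]: "Poly_Mapping.keys (var_poly v) = {Poly_Mapping.single v 1}"
  by (simp add: var_poly_def)

lemma var_poly_nonzero [simp]: "var_poly v \<noteq> 0"
  by (metis keys_var_poly keys_zero insert_not_empty)

lemma lin_coeff_var_poly [simp]: "lin_coeff (var_poly v) v = 1"
  by (simp add: lin_coeff_def var_poly_def)

text \<open>An upper bound on the monomials is all that affinity asks for.\<close>

lemma keys_one_minus_var_poly:
  "Poly_Mapping.keys (1 - var_poly v) \<subseteq> {0, Poly_Mapping.single v 1}"
  using keys_diff[of 1 "var_poly v"] by (auto simp: keys_one)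

text \<open>State \<open>0\<close> tosses the coin, state \<open>1\<close> is absorbing and means
  heads; parameter \<open>0\<close> is the probability of heads.\<close>

definition coin_pmdp :: "(nat, nat, nat) pmdp" where
  "coin_pmdp = \<lparr> states = {0, 1}, init = 0, actions = {0}, params = {0},
     trans = (\<lambda>s \<alpha> s'. if s = 0 then (if s' = 0 then 1 - var_poly 0 else var_poly 0)
                      else (if s' = 0 then 0 else 1)) \<rparr>"

text \<open>From either state the transition to \<open>1\<close> is a nonzero polynomial.\<close>

lemma enabled_coin_pmdp: "s \<in> {0, 1} \<Longrightarrow> enabled coin_pmdp s = {0}"
  by (auto simp: enabled_def coin_pmdp_def)

lemma affine_coin_pmdp: "affine_pmdp coin_pmdp"
proof -
  have mono: "Poly_Mapping.keys m \<subseteq> {0} \<and>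
      (\<Sum>v\<in>Poly_Mapping.keys m. Poly_Mapping.lookup m v) \<le> 1"
    if "m \<in> Poly_Mapping.keys (trans coin_pmdp s \<alpha> s')" for s \<alpha> s' m
  proof -
    have "m = 0 \<or> m = Poly_Mapping.single 0 1"
      using that keys_one_minus_var_poly[of 0]
      by (auto simp: coin_pmdp_def keys_one split: if_splits)
    then show ?thesis by auto
  qed
  then have "poly_vars (trans coin_pmdp s \<alpha> s') \<subseteq> {0}" "affine_poly (trans coin_pmdp s \<alpha> s')"
    for s \<alpha> s'
    unfolding poly_vars_def affine_poly_def by blast+
  then show ?thesis
    using enabled_coin_pmdp by (simp add: affine_pmdp_def is_pmdp_def) (simp add: coin_pmdp_def)
qed

theorem theorem1:
  shows "\<exists>(M :: (nat, nat, nat) pmdp) (T :: nat set) (thr :: real) (\<epsilon> :: real).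
    affine_pmdp M \<and> T \<subseteq> states M \<and> 0 \<le> thr \<and> thr \<le> 1 \<and> \<epsilon> > 0 \<and>
    nonconvex_qcqp (synthesis_qcqp M T thr \<epsilon>) \<and>
    (\<exists>s \<in> states M - T. \<exists>\<alpha> \<in> enabled M s. \<not> psd (qcqp_indices M) (quad_mat M s \<alpha>))"
proof -
  let ?M = coin_pmdp
  \<comment> \<open>State \<open>0\<close> stays outside the target, so its quadratic constraint is
    present. The program is even feasible: take the fair coin and both probability variables equal
    to 1.\<close>
  let ?Q = "synthesis_qcqp ?M {1} 1 (1 / 2)"
  have T: "{1} \<subseteq> states ?M" and s: "0 \<in> states ?M - {1}" and \<alpha>: "0 \<in> enabled ?M 0"
    \<comment> \<open>\<open>enabled_coin_pmdp\<close> has to rewrite before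
      \<open>coin_pmdp\<close> is unfolded, or it no longer matches.\<close>
    by (simp_all add: enabled_coin_pmdp) (simp_all add: coin_pmdp_def)
  have np: "\<not> psd (qcqp_indices ?M) (quad_mat ?M 0 0)"
    \<comment> \<open>The move from tossing to heads has coefficient 1 in the bias.\<close>
    by (rule not_psd_quad_mat[where s' = 1 and v = 0]) (simp_all add: coin_pmdp_def)
  have "quad_con ?M 0 0 \<in> constraints ?Q"
    using s \<alpha> by (auto simp: synthesis_qcqp_def)
  moreover have "case quad_con ?M 0 0 of (P, q, r) \<Rightarrow> \<not> psd (indices ?Q) P"
    using np by (simp add: quad_con_def synthesis_qcqp_def)
  ultimately have "nonconvex_qcqp ?Q"
    unfolding nonconvex_qcqp_def
    by (intro conjI is_qcqp_synthesis[OF affine_coin_pmdp T] bexI[where x = "quad_con ?M 0 0"]) auto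
  moreover have "0 \<le> (1 :: real)" "(1 :: real) \<le> 1" "(1 / 2 :: real) > 0" by simp_all
  ultimately show ?thesis using affine_coin_pmdp T s \<alpha> np by blast
qed

end
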